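(* There is a universal constant $C$, and $C = 22$ suffices, such that the following holds. Let $n, d \ge 1$ be integers and let $V_1, \dots, V_n \subseteq B_\infty^d$ be sets of vectors (vector families) with $0 \in \sum_{i=1}^n \mathrm{conv}\, V_i$. Then there exist $v_i \in V_i$ for $i = 1, \dots, n$ such that $$\Big\| \sum_{i=1}^n v_i \Big\|_\infty \le C \sqrt{d}.$$
   Context: $B_\infty^d = \{x \in \mathbb{R}^d : \|x\|_\infty \le 1\}$ is the closed unit ball of the maximum norm on $\mathbb{R}^d$, $\mathrm{conv}$ denotes the convex hull, and $\sum_{i=1}^n \mathrm{conv}\, V_i$ is the Minkowski sum $\{x_1 + \dots + x_n : x_i \in \mathrm{conv}\, V_i\}$. *)

theory Defs
  imports "HOL-Analysis.Analysis" "HOL-Library.Set_Algebras"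
begin

definition ball_inf :: "(real ^ 'd) set" where
  "ball_inf = {x. infnorm x \<le> 1}"

end

theory Submission
  imports Defs
begin

text \<open>Write \<open>0\<close> as a sum of convex combinations, one from each family. The coefficients form a point of a product of
simplices, and the theorem asks for a vertex of this polytope at which all coordinates of the weighted sum are
at most \<open>22 * sqrt d\<close>. The vertex is approached through extremal points of suitable functions; at each of them,
an improving direction exists as long as many coefficients are fractional.

A point that minimises the defect, i.e. the sum of \<open>x p * (1 - x p)\<close>, among those with weighted sum \<open>0\<close> has a
tangent space of dimension at most \<open>d\<close>, since otherwise one can move inside the kernel of the \<open>d\<close> coordinate
forms (\<open>few_free_atoms\<close>). Each family with fractional coefficients contributes at least one dimension, so at
most \<open>d\<close> families are still undecided and the defect is at most \<open>d\<close>.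

For the next phase the coordinates may deviate from \<open>0\<close>. Each signed coordinate is kept below a
bound that rises from \<open>5 * sqrt d\<close> to \<open>11 * sqrt d\<close> while the defect drops from \<open>d\<close> to \<open>0\<close>, and the potential is
the sum of the inverse squared distances to this bound. A second-order comparison at a minimiser of the
potential shows that its tangent space has dimension at most \<open>10\<close> (\<open>balanced_weights_with_few_free\<close>):
in a larger space one can freeze the critical coordinates, those closest to the bound, and average over the
remaining directions (\<open>light_direction\<close>), to find a direction along which the rise of the bound outweighs the
convexity of the potential.

At most \<open>10\<close> families are then undecided, and choosing arbitrarily in them costs at most \<open>20\<close>. This is at most
\<open>11 * sqrt d\<close> for \<open>d \<ge> 4\<close>; for smaller \<open>d\<close> the first phase alone suffices.\<close>

section \<open>Orthonormal systems on finite index sets\<close>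

text \<open>Gaussian elimination of one coordinate per equation. Equations are kept as a set of coefficient vectors:
two of them may coincide after an elimination, which only lowers the cardinality. The number of
coordinates depends on the weights under consideration, so they form a finite set and not a type.\<close>

lemma underdetermined_system_nontrivial:
  fixes Q :: "('p \<Rightarrow> real) set"
  assumes "finite Q" "finite I" "card Q < card I"
  shows "\<exists>x. (\<exists>i\<in>I. x i \<noteq> 0) \<and> (\<forall>i. i \<notin> I \<longrightarrow> x i = 0) \<and> (\<forall>c\<in>Q. (\<Sum>i\<in>I. c i * x i) = 0)"
  using assms
proof (induction "card Q" arbitrary: Q I rule: less_induct)
  case less
  show ?case
  proof (cases "Q = {}")
    case True
    then obtain i where "i \<in> I" using less.prems by fastforce
    then show ?thesis
      by (intro exI[of _ "\<lambda>j. if j = i then 1 else 0"]) (auto simp: True)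
  next
    case False
    then obtain c where c: "c \<in> Q" by blast
    have cardQ: "card (Q - {c}) < card Q" "finite (Q - {c})" "card Q = Suc (card (Q - {c}))"
      using card_Diff1_less[OF less.prems(1) c] card.remove[OF less.prems(1) c] less.prems(1)
      by blast+
    show ?thesis
    proof (cases "\<forall>i\<in>I. c i = 0")
      case True
      have "card (Q - {c}) < card I" using cardQ less.prems by linarith
      from less.hyps[OF cardQ(1,2) less.prems(2) this]
      obtain x where x: "\<exists>i\<in>I. x i \<noteq> 0" "\<forall>i. i \<notin> I \<longrightarrow> x i = 0"
        "\<forall>c\<in>Q - {c}. (\<Sum>i\<in>I. c i * x i) = 0" by blast
      have "(\<Sum>i\<in>I. c i * x i) = 0" using True by simp
      then show ?thesis using x by blast
    next
      case False
      then obtain p where p: "p \<in> I" "c p \<noteq> 0" by blast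
      define red where "red = (\<lambda>(g::'p \<Rightarrow> real) i. g i - g p * c i / c p)"
      define Q' where "Q' = red ` (Q - {c})"
      have Q': "finite Q'" "card Q' \<le> card (Q - {c})"
        using cardQ card_image_le[of "Q - {c}" red] by (auto simp: Q'_def)
      have cardI: "card I = Suc (card (I - {p}))" "finite (I - {p})"
        using card.remove[OF less.prems(2) p(1)] less.prems(2) by blast+
      have "card Q' < card Q" "card Q' < card (I - {p})"
        using Q' cardQ cardI less.prems by linarith+
      from less.hyps[OF this(1) Q'(1) cardI(2) this(2)]
      obtain x where x: "\<exists>i\<in>I - {p}. x i \<noteq> 0" "\<forall>i. i \<notin> I - {p} \<longrightarrow> x i = 0"
        "\<forall>c\<in>Q'. (\<Sum>i\<in>I - {p}. c i * x i) = 0" by blast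
      define y where "y = x(p := - (\<Sum>i\<in>I - {p}. c i * x i) / c p)"
      have split: "(\<Sum>i\<in>I. g i * y i) = g p * y p + (\<Sum>i\<in>I - {p}. g i * x i)" for g
        using p less.prems by (subst sum.remove[of I p]) (auto simp: y_def intro!: sum.cong)
      have "(\<Sum>i\<in>I. g i * y i) = 0" if g: "g \<in> Q" for g
      proof (cases "g = c")
        case True
        then show ?thesis using p by (simp add: split) (simp add: y_def)
      next
        case False
        then have "(\<Sum>i\<in>I - {p}. red g i * x i) = 0" using g x(3) by (auto simp: Q'_def)
        moreover have "(\<Sum>i\<in>I - {p}. red g i * x i)
            = (\<Sum>i\<in>I - {p}. g i * x i) - g p / c p * (\<Sum>i\<in>I - {p}. c i * x i)"
          by (simp add: red_def left_diff_distrib sum_subtractf sum_distrib_left algebra_simps)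
        ultimately show ?thesis by (simp add: split) (simp add: y_def)
      qed
      moreover have "\<exists>i\<in>I. y i \<noteq> 0" "\<forall>i. i \<notin> I \<longrightarrow> y i = 0"
        using x p by (auto simp: y_def)
      ultimately show ?thesis by blast
    qed
  qed
qed

lemma orthonormal_system_in_annihilator:
  fixes Q :: "('p \<Rightarrow> real) set"
  assumes "finite Q" "finite I" "card Q + D \<le> card I"
  shows "\<exists>E. finite E \<and> card E = D \<and> (\<forall>e\<in>E. \<forall>i. i \<notin> I \<longrightarrow> e i = 0) \<and>
     (\<forall>e\<in>E. \<forall>f\<in>E. (\<Sum>i\<in>I. e i * f i) = (if e = f then 1 else 0)) \<and>
     (\<forall>e\<in>E. \<forall>c\<in>Q. (\<Sum>i\<in>I. c i * e i) = 0)"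
  using assms(3)
proof (induction D)
  case 0
  show ?case by (intro exI[of _ "{}"]) simp
next
  case (Suc D)
  then obtain E where E: "finite E" "card E = D" "\<And>e i. e \<in> E \<Longrightarrow> i \<notin> I \<Longrightarrow> e i = 0"
     "\<And>e f. e \<in> E \<Longrightarrow> f \<in> E \<Longrightarrow> (\<Sum>i\<in>I. e i * f i) = (if e = f then 1 else 0)"
     "\<And>e c. e \<in> E \<Longrightarrow> c \<in> Q \<Longrightarrow> (\<Sum>i\<in>I. c i * e i) = 0" by auto
  have "card (Q \<union> E) < card I" using card_Un_le[of Q E] E Suc.prems by linarith
  from underdetermined_system_nontrivial[OF _ assms(2) this]
  obtain x where x: "\<exists>i\<in>I. x i \<noteq> 0" "\<And>i. i \<notin> I \<Longrightarrow> x i = 0"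
    "\<And>c. c \<in> Q \<union> E \<Longrightarrow> (\<Sum>i\<in>I. c i * x i) = 0" using assms(1) E(1) by auto
  define s where "s = (\<Sum>i\<in>I. x i * x i)"
  have s: "s > 0"
  proof -
    obtain i where i: "i \<in> I" "x i \<noteq> 0" using x(1) by blast
    then have "0 < x i * x i" by (auto simp: zero_less_mult_iff)
    also have "\<dots> \<le> s" unfolding s_def by (rule member_le_sum) (use i assms(2) in auto)
    finally show ?thesis .
  qed
  define e where "e = (\<lambda>i. x i / sqrt s)"
  have perp: "(\<Sum>i\<in>I. c i * e i) = 0" if "c \<in> Q \<union> E" for c
    using x(3)[OF that] by (simp add: e_def sum_divide_distrib[symmetric])
  have unit: "(\<Sum>i\<in>I. e i * e i) = 1"
    using s by (simp add: e_def sum_divide_distrib[symmetric] s_def[symmetric])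
  have new: "e \<notin> E" using perp[of e] unit by auto
  have perp': "(\<Sum>i\<in>I. e i * f i) = 0" if "f \<in> E" for f
    using perp[of f] that by (simp add: mult.commute)
  show ?case
    by (intro exI[of _ "insert e E"]) (use new perp' E perp unit x(2) in \<open>auto simp: e_def\<close>)
qed

lemma Bessel_sum_le:
  fixes a :: "'p \<Rightarrow> real"
  assumes "finite I" "finite E"
    and orth: "\<forall>e\<in>E. \<forall>f\<in>E. (\<Sum>i\<in>I. e i * f i) = (if e = f then 1 else 0)"
  shows "(\<Sum>e\<in>E. (\<Sum>i\<in>I. a i * e i)\<^sup>2) \<le> (\<Sum>i\<in>I. (a i)\<^sup>2)"
proof -
  define c where "c e = (\<Sum>i\<in>I. a i * e i)" for e
  define g where "g i = (\<Sum>e\<in>E. c e * e i)" for i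
  have ag: "(\<Sum>i\<in>I. a i * g i) = (\<Sum>e\<in>E. (c e)\<^sup>2)"
    unfolding g_def sum_distrib_left
    by (subst sum.swap) (auto intro!: sum.cong simp: c_def power2_eq_square sum_distrib_left mult_ac)
  have eg: "(\<Sum>i\<in>I. e i * g i) = c e" if "e \<in> E" for e
  proof -
    have "(\<Sum>i\<in>I. e i * g i) = (\<Sum>f\<in>E. c f * (\<Sum>i\<in>I. e i * f i))"
      unfolding g_def sum_distrib_left
      by (subst sum.swap) (auto intro!: sum.cong simp: mult_ac)
    also have "\<dots> = (\<Sum>f\<in>E. if f = e then c f else 0)"
      using orth that by (intro sum.cong) auto
    finally show ?thesis using that assms(2) by simp
  qed
  have gg: "(\<Sum>i\<in>I. g i * g i) = (\<Sum>e\<in>E. (c e)\<^sup>2)"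
  proof -
    have "(\<Sum>i\<in>I. g i * g i) = (\<Sum>i\<in>I. \<Sum>e\<in>E. c e * (e i * g i))"
      by (intro sum.cong refl, subst (1) g_def) (simp add: sum_distrib_right mult.assoc)
    also have "\<dots> = (\<Sum>e\<in>E. c e * (\<Sum>i\<in>I. e i * g i))"
      by (subst sum.swap) (simp add: sum_distrib_left)
    also have "\<dots> = (\<Sum>e\<in>E. (c e)\<^sup>2)"
      by (intro sum.cong) (auto simp: eg power2_eq_square)
    finally show ?thesis .
  qed
  have "0 \<le> (\<Sum>i\<in>I. (a i - g i)\<^sup>2)" by (simp add: sum_nonneg)
  also have "\<dots> = (\<Sum>i\<in>I. (a i)\<^sup>2) - 2 * (\<Sum>i\<in>I. a i * g i) + (\<Sum>i\<in>I. g i * g i)"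
    by (simp add: power2_diff sum.distrib sum_subtractf sum_distrib_left mult.assoc flip: power2_eq_square)
  finally show ?thesis by (simp add: ag gg c_def)
qed

text \<open>By Bessel, every \<open>a r\<close> with entries in \<open>[-1,1]\<close> has total squared length at most \<open>card I\<close>
against an orthonormal system in the annihilator of \<open>Q\<close>. Such a system has \<open>card I - card Q\<close> members,
so some member does no worse than the average.\<close>

lemma light_direction:
  fixes Q :: "('p \<Rightarrow> real) set" and a :: "'r \<Rightarrow> 'p \<Rightarrow> real"
  assumes "finite Q" "finite I" "finite R" "card Q < card I"
    and w: "\<And>r. r \<in> R \<Longrightarrow> 0 \<le> w r"
    and a: "\<And>r i. r \<in> R \<Longrightarrow> i \<in> I \<Longrightarrow> \<bar>a r i\<bar> \<le> 1"
  shows "\<exists>e. (\<forall>i. i \<notin> I \<longrightarrow> e i = 0) \<and> (\<Sum>i\<in>I. e i * e i) = 1 \<and>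
     (\<forall>c\<in>Q. (\<Sum>i\<in>I. c i * e i) = 0) \<and>
     (real (card I) - real (card Q)) * (\<Sum>r\<in>R. w r * (\<Sum>i\<in>I. a r i * e i)\<^sup>2)
       \<le> real (card I) * (\<Sum>r\<in>R. w r)"
proof -
  define D where "D = card I - card Q"
  have D: "card Q + D \<le> card I" "D > 0" "real D = real (card I) - real (card Q)"
    using assms(4) by (auto simp: D_def)
  from orthonormal_system_in_annihilator[OF assms(1,2) D(1)]
  obtain E where E: "finite E" "card E = D" "\<forall>e\<in>E. \<forall>i. i \<notin> I \<longrightarrow> e i = 0"
     "\<forall>e\<in>E. \<forall>f\<in>E. (\<Sum>i\<in>I. e i * f i) = (if e = f then 1 else 0)"
     "\<forall>e\<in>E. \<forall>c\<in>Q. (\<Sum>i\<in>I. c i * e i) = 0" by blast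
  define q where "q e = (\<Sum>r\<in>R. w r * (\<Sum>i\<in>I. a r i * e i)\<^sup>2)" for e
  have "(\<Sum>e\<in>E. q e) = (\<Sum>r\<in>R. w r * (\<Sum>e\<in>E. (\<Sum>i\<in>I. a r i * e i)\<^sup>2))"
    unfolding q_def by (subst sum.swap) (simp add: sum_distrib_left)
  also have "\<dots> \<le> (\<Sum>r\<in>R. w r * real (card I))"
  proof (intro sum_mono mult_left_mono w)
    fix r assume r: "r \<in> R"
    have "(\<Sum>e\<in>E. (\<Sum>i\<in>I. a r i * e i)\<^sup>2) \<le> (\<Sum>i\<in>I. (a r i)\<^sup>2)"
      by (rule Bessel_sum_le) (use assms(2) E in auto)
    also have "\<dots> \<le> (\<Sum>i\<in>I. 1)"
      by (intro sum_mono) (use a[OF r] in \<open>simp add: abs_square_le_1\<close>)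
    finally show "(\<Sum>e\<in>E. (\<Sum>i\<in>I. a r i * e i)\<^sup>2) \<le> real (card I)" by simp
  qed
  also have "\<dots> = real (card I) * (\<Sum>r\<in>R. w r)" by (simp add: sum_distrib_right mult.commute)
  finally have total: "(\<Sum>e\<in>E. q e) \<le> real (card I) * (\<Sum>r\<in>R. w r)" .
  have "\<exists>e\<in>E. real D * q e \<le> real (card I) * (\<Sum>r\<in>R. w r)"
  proof (rule ccontr)
    assume "\<not> ?thesis"
    then have "(\<Sum>e\<in>E. real (card I) * (\<Sum>r\<in>R. w r)) < (\<Sum>e\<in>E. real D * q e)"
      using E(1,2) D(2) by (intro sum_strict_mono) (auto simp: not_le)
    then show False using total D(2) by (simp add: sum_distrib_left[symmetric] E(2))
  qed
  then obtain e where "e \<in> E" "real D * q e \<le> real (card I) * (\<Sum>r\<in>R. w r)" by blast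
  then show ?thesis using E by (intro exI[of _ e]) (auto simp: q_def D(3))
qed

section \<open>The polytope of weights\<close>

text \<open>An atom stands for a vector together with the family that it is taken from, and \<open>col\<close> names that
family. Keeping the family in the atom lets the same vector occur in several families.\<close>

locale partitioned_atoms =
  fixes P :: "'p set" and K :: "'k set" and col :: "'p \<Rightarrow> 'k"
  assumes finite_atoms: "finite P" and finite_classes: "finite K" and col_in: "col ` P \<subseteq> K"
begin

text \<open>Points are functions on the whole type that vanish off \<open>P\<close>, so that the product topology makes this a compact
set.\<close>

definition weights :: "('p \<Rightarrow> real) set" where
  "weights = {x. (\<forall>p. p \<notin> P \<longrightarrow> x p = 0) \<and> (\<forall>p\<in>P. 0 \<le> x p) \<and>
                 (\<forall>i\<in>K. (\<Sum>p | p \<in> P \<and> col p = i. x p) = 1)}"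

definition free :: "('p \<Rightarrow> real) \<Rightarrow> 'p set" where
  "free x = {p\<in>P. 0 < x p \<and> x p < 1}"

definition free_classes :: "('p \<Rightarrow> real) \<Rightarrow> 'k set" where
  "free_classes x = col ` free x"

text \<open>On \<open>weights\<close> this is \<open>card K\<close> minus the squared Euclidean norm, and \<open>card K\<close> is the squared norm of every
vertex. It measures how far the rounding has progressed: it vanishes exactly at the vertices.\<close>

definition defect :: "('p \<Rightarrow> real) \<Rightarrow> real" where
  "defect x = (\<Sum>p\<in>P. x p * (1 - x p))"

definition lin :: "('p \<Rightarrow> real) \<Rightarrow> ('p \<Rightarrow> real) \<Rightarrow> real" where
  "lin a x = (\<Sum>p\<in>P. a p * x p)"

text \<open>For \<open>x\<close> in \<open>weights\<close>, the directions of the face whose relative interior contains \<open>x\<close>; both signs of such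
a direction can be followed for a short time.\<close>

definition tangent :: "('p \<Rightarrow> real) \<Rightarrow> ('p \<Rightarrow> real) set" where
  "tangent x = {\<delta>. (\<forall>p. p \<notin> free x \<longrightarrow> \<delta> p = 0) \<and>
                    (\<forall>i\<in>K. (\<Sum>p | p \<in> P \<and> col p = i. \<delta> p) = 0)}"

definition move :: "('p \<Rightarrow> real) \<Rightarrow> ('p \<Rightarrow> real) \<Rightarrow> real \<Rightarrow> 'p \<Rightarrow> real" where
  "move x \<delta> e = (\<lambda>p. x p + e * \<delta> p)"

definition class_indicator :: "'k \<Rightarrow> 'p \<Rightarrow> real" where
  "class_indicator i = (\<lambda>p. if col p = i then 1 else 0)"

lemma free_subset: "free x \<subseteq> P" and finite_free: "finite (free x)"
  using finite_atoms by (auto simp: free_def)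

lemma finite_free_classes: "finite (free_classes x)"
  by (simp add: free_classes_def finite_free)

lemma free_classes_subset: "free_classes x \<subseteq> K"
  using col_in by (auto simp: free_classes_def free_def)

lemma sum_by_classes: "(\<Sum>i\<in>K. \<Sum>p | p \<in> P \<and> col p = i. f p) = (\<Sum>p\<in>P. f p)"
  by (rule sum.group[OF finite_atoms finite_classes col_in])

lemma sum_by_free_classes:
  "(\<Sum>i\<in>free_classes x. \<Sum>p | p \<in> free x \<and> col p = i. f p) = (\<Sum>p\<in>free x. f p)"
  by (rule sum.group) (auto simp: finite_free finite_free_classes free_classes_def)

lemma weights_nonneg: "x \<in> weights \<Longrightarrow> 0 \<le> x p"
  by (cases "p \<in> P") (auto simp: weights_def)

lemma class_part_le_1:
  assumes "x \<in> weights" "i \<in> K" "S \<subseteq> {p\<in>P. col p = i}"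
  shows "sum x S \<le> 1"
proof -
  have "sum x S \<le> (\<Sum>p | p \<in> P \<and> col p = i. x p)"
    by (rule sum_mono2) (use finite_atoms assms weights_nonneg in auto)
  then show ?thesis using assms by (simp add: weights_def)
qed

lemma weights_le_1:
  assumes "x \<in> weights" shows "x p \<le> 1"
proof (cases "p \<in> P")
  case True
  then have "sum x {p} \<le> 1" by (intro class_part_le_1[OF assms, of "col p"]) (use col_in in auto)
  then show ?thesis by simp
qed (use assms in \<open>simp add: weights_def\<close>)

lemma class_has_positive:
  assumes "x \<in> weights" "i \<in> K"
  shows "\<exists>p\<in>P. col p = i \<and> 0 < x p"
proof (rule ccontr)
  assume "\<not> ?thesis"
  then have "(\<Sum>p | p \<in> P \<and> col p = i. x p) \<le> 0"
    by (intro sum_nonpos) (auto simp: not_less)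
  then show False using assms by (simp add: weights_def)
qed

text \<open>Weights of a class add up to an integer, so a fractional one does not come alone.\<close>

lemma two_free_per_class:
  assumes x: "x \<in> weights" and i: "i \<in> free_classes x"
  shows "2 \<le> card {p\<in>free x. col p = i}"
proof -
  have iK: "i \<in> K" using i free_classes_subset by blast
  obtain p where p: "p \<in> free x" "col p = i" using i by (auto simp: free_classes_def)
  have pP: "p \<in> P" using p free_subset by blast
  have "\<exists>q\<in>P - {p}. col q = i \<and> 0 < x q"
  proof (rule ccontr)
    assume "\<not> ?thesis"
    then have "(\<Sum>q\<in>{q\<in>P. col q = i} - {p}. x q) \<le> 0"
      by (intro sum_nonpos) (auto simp: not_less)
    moreover have "(\<Sum>q | q \<in> P \<and> col q = i. x q) = x p + (\<Sum>q\<in>{q\<in>P. col q = i} - {p}. x q)"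
      using p pP finite_atoms by (intro sum.remove) auto
    ultimately show False using x iK p by (simp add: weights_def free_def)
  qed
  then obtain q where q: "q \<in> P" "q \<noteq> p" "col q = i" "0 < x q" by blast
  have "sum x {p, q} \<le> 1" by (rule class_part_le_1[OF x iK]) (use p pP q in auto)
  then have "x q < 1" using q(2) p by (simp add: free_def)
  then have "{p, q} \<subseteq> {p\<in>free x. col p = i}" using p q by (auto simp: free_def)
  then have "card {p, q} \<le> card {p\<in>free x. col p = i}"
    by (rule card_mono[rotated]) (simp add: finite_free)
  then show ?thesis using q(2) by simp
qed

lemma card_free_ge:
  assumes "x \<in> weights"
  shows "2 * card (free_classes x) \<le> card (free x)"
proof -
  have "2 * card (free_classes x) = (\<Sum>i\<in>free_classes x. 2)" by simp
  also have "\<dots> \<le> (\<Sum>i\<in>free_classes x. card {p\<in>free x. col p = i})"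
    by (intro sum_mono two_free_per_class[OF assms])
  also have "\<dots> = card (free x)"
    using sum_by_free_classes[of "\<lambda>_. 1::nat" x] by simp
  finally show ?thesis .
qed

lemma defect_eq_sum_free:
  assumes "x \<in> weights" shows "defect x = (\<Sum>p\<in>free x. x p * (1 - x p))"
  unfolding defect_def
proof (rule sum.mono_neutral_right[OF finite_atoms free_subset], intro ballI)
  fix p assume "p \<in> P - free x"
  then show "x p * (1 - x p) = 0"
    using weights_nonneg[OF assms, of p] weights_le_1[OF assms, of p] by (auto simp: free_def)
qed

text \<open>On a class, \<open>x p * (1 - x p) \<le> x p\<close>, and the weights of the class add up to \<open>1\<close>; classes without free atoms
contribute nothing.\<close>

lemma defect_le:
  assumes "x \<in> weights" shows "defect x \<le> card (free_classes x)"
proof -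
  have "defect x \<le> (\<Sum>p\<in>free x. x p)"
    unfolding defect_eq_sum_free[OF assms]
    by (intro sum_mono) (auto simp: free_def mult_le_cancel_left1)
  also have "\<dots> = (\<Sum>i\<in>free_classes x. \<Sum>p | p \<in> free x \<and> col p = i. x p)"
    by (rule sum_by_free_classes[symmetric])
  also have "\<dots> \<le> (\<Sum>i\<in>free_classes x. 1)"
    by (intro sum_mono class_part_le_1[OF assms]) (use free_classes_subset free_subset in auto)
  finally show ?thesis by simp
qed

lemma defect_nonneg: "x \<in> weights \<Longrightarrow> 0 \<le> defect x"
  unfolding defect_def by (intro sum_nonneg) (simp add: weights_nonneg weights_le_1)

lemma defect_pos:
  assumes "x \<in> weights" "free x \<noteq> {}" shows "0 < defect x"
  unfolding defect_eq_sum_free[OF assms(1)]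
  by (intro sum_pos finite_free assms(2)) (auto simp: free_def)

lemma continuous_on_lin [continuous_intros]: "continuous_on S (lin a)"
  unfolding lin_def by (intro continuous_intros continuous_on_subset[OF continuous_on_product_coordinates]) auto

lemma continuous_on_defect [continuous_intros]: "continuous_on S defect"
  unfolding defect_def by (intro continuous_intros continuous_on_subset[OF continuous_on_product_coordinates]) auto

lemma compact_weights: "compact weights"
proof -
  have "compactin (product_topology (\<lambda>i::'p. euclidean :: real topology) UNIV) (PiE UNIV (\<lambda>_. {0..1}))"
    by (simp add: compactin_PiE)
  then have box: "compact (PiE UNIV (\<lambda>_::'p. {0..1::real}))"
    by (simp add: euclidean_product_topology)
  have "weights = (\<Inter>p\<in>-P. {x. x p = 0}) \<inter> (\<Inter>p\<in>P. {x. 0 \<le> x p}) \<inter>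
      (\<Inter>i\<in>K. {x. (\<Sum>p | p \<in> P \<and> col p = i. x p) = 1})"
    by (auto simp: weights_def)
  then have "closed weights"
    by (auto intro!: closed_INT closed_Int closed_Collect_eq closed_Collect_le continuous_intros)
  moreover have "weights \<subseteq> PiE UNIV (\<lambda>_::'p. {0..1::real})"
    by (auto simp: weights_nonneg weights_le_1)
  ultimately show ?thesis
    using compact_Int_closed[OF box, of weights] by (metis Int_absorb1)
qed

lemma tangentI:
  assumes supp: "\<forall>p. p \<notin> free x \<longrightarrow> \<delta> p = 0"
    and cls: "\<forall>i\<in>free_classes x. (\<Sum>p\<in>free x. class_indicator i p * \<delta> p) = 0"
  shows "\<delta> \<in> tangent x"
proof -
  have "(\<Sum>p | p \<in> P \<and> col p = i. \<delta> p) = 0" if "i \<in> K" for i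
  proof (cases "i \<in> free_classes x")
    case True
    have "(\<Sum>p | p \<in> P \<and> col p = i. \<delta> p) = (\<Sum>p\<in>P. class_indicator i p * \<delta> p)"
      unfolding sum.inter_filter[OF finite_atoms] class_indicator_def by (intro sum.cong) auto
    also have "\<dots> = (\<Sum>p\<in>free x. class_indicator i p * \<delta> p)"
      using supp by (intro sum.mono_neutral_right finite_atoms free_subset) auto
    finally show ?thesis using cls True by simp
  next
    case False
    then show ?thesis using supp by (intro sum.neutral) (auto simp: free_classes_def)
  qed
  then show ?thesis using supp by (simp add: tangent_def)
qed

lemma sum_free_eq:
  fixes c :: "'p \<Rightarrow> real"
  assumes "\<forall>p. p \<notin> free x \<longrightarrow> \<delta> p = 0"
  shows "(\<Sum>p\<in>free x. c p * \<delta> p) = (\<Sum>p\<in>P. c p * \<delta> p)"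
  using assms by (intro sum.mono_neutral_left finite_atoms free_subset) auto

lemma lin_move: "lin a (move x \<delta> e) = lin a x + e * lin a \<delta>"
  by (simp add: lin_def move_def distrib_left sum.distrib sum_distrib_left mult_ac)

lemma defect_move:
  assumes "\<delta> \<in> tangent x"
  shows "defect (move x \<delta> e) = defect x - 2 * e * lin x \<delta> - e\<^sup>2 * lin \<delta> \<delta>"
proof -
  have "(\<Sum>p\<in>P. \<delta> p) = 0"
    using assms by (simp add: sum_by_classes[of \<delta>, symmetric] tangent_def)
  moreover have "defect (move x \<delta> e)
      = defect x + e * (\<Sum>p\<in>P. \<delta> p) - 2 * e * lin x \<delta> - e\<^sup>2 * lin \<delta> \<delta>"
    by (simp add: defect_def move_def lin_def sum_distrib_left flip: sum.distrib sum_subtractf)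
       (intro sum.cong, auto simp: algebra_simps power2_eq_square)
  ultimately show ?thesis by simp
qed

lemma eventually_move_in_weights:
  assumes x: "x \<in> weights" and d: "\<delta> \<in> tangent x"
  shows "\<forall>\<^sub>F e in nhds 0. move x \<delta> e \<in> weights"
proof -
  have "\<forall>\<^sub>F e in nhds 0. \<forall>p\<in>P. 0 \<le> x p + e * \<delta> p"
  proof (rule eventually_ball_finite[OF finite_atoms], rule ballI)
    fix p assume p: "p \<in> P"
    show "\<forall>\<^sub>F e in nhds 0. 0 \<le> x p + e * \<delta> p"
    proof (cases "p \<in> free x")
      case True
      have "((\<lambda>e. x p + e * \<delta> p) \<longlongrightarrow> x p + 0 * \<delta> p) (nhds 0)"
        by (intro tendsto_intros filterlim_ident)
      from order_tendstoD(1)[OF this, of 0] True show ?thesis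
        by (auto simp: free_def elim!: eventually_mono)
    next
      case False
      then show ?thesis using d weights_nonneg[OF x] by (simp add: tangent_def)
    qed
  qed
  then show ?thesis
  proof eventually_elim
    case (elim e)
    have "\<delta> p = 0" if "p \<notin> P" for p using that d free_subset by (auto simp: tangent_def)
    then show ?case using elim x d
      by (auto simp: weights_def move_def tangent_def sum.distrib simp flip: sum_distrib_left)
  qed
qed

text \<open>A minimiser of the defect under the constraints \<open>lin (a j)\<close> has few free atoms: otherwise there is a
tangent direction along which all constraints stay constant, and the defect, being strictly concave,
decreases along it in one of the two orientations.\<close>

lemma few_free_atoms:
  fixes a :: "'j \<Rightarrow> 'p \<Rightarrow> real"
  assumes x: "x \<in> weights" and J: "finite J"
  shows "\<exists>y\<in>weights. (\<forall>j\<in>J. lin (a j) y = lin (a j) x) \<and>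
           card (free y) \<le> card (free_classes y) + card J"
proof -
  define M where "M = weights \<inter> (\<Inter>j\<in>J. {y. lin (a j) y = lin (a j) x})"
  have "compact M" unfolding M_def
    by (intro compact_Int_closed compact_weights closed_INT ballI closed_Collect_eq continuous_intros)
  moreover have "x \<in> M" using x by (simp add: M_def)
  ultimately obtain y where y: "y \<in> M" and min: "\<And>z. z \<in> M \<Longrightarrow> defect y \<le> defect z"
    using continuous_attains_inf[of M defect] continuous_on_defect by blast
  have yw: "y \<in> weights" and yl: "\<And>j. j \<in> J \<Longrightarrow> lin (a j) y = lin (a j) x"
    using y by (auto simp: M_def)
  have "card (free y) \<le> card (free_classes y) + card J"
  proof (rule ccontr)
    assume many: "\<not> ?thesis"
    define Q where "Q = class_indicator ` free_classes y \<union> a ` J"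
    have "card Q \<le> card (class_indicator ` free_classes y) + card (a ` J)"
      unfolding Q_def by (rule card_Un_le)
    also have "\<dots> \<le> card (free_classes y) + card J"
      by (intro add_mono card_image_le finite_free_classes J)
    finally have "card Q < card (free y)" using many by linarith
    moreover have "finite Q" by (simp add: Q_def finite_free_classes J)
    ultimately obtain g where g: "\<exists>p\<in>free y. g p \<noteq> 0" "\<forall>p. p \<notin> free y \<longrightarrow> g p = 0"
      "\<forall>c\<in>Q. (\<Sum>p\<in>free y. c p * g p) = 0"
      using underdetermined_system_nontrivial[OF _ finite_free, of Q y] by blast
    have gl: "lin (a j) g = 0" if "j \<in> J" for j
      using g(3) that sum_free_eq[OF g(2), of "a j"] by (simp add: Q_def lin_def)
    have "g \<in> tangent y" by (rule tangentI) (use g in \<open>auto simp: Q_def\<close>)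
    \<comment> \<open>Orient the direction so that the linear term of the defect does not increase.\<close>
    define \<delta> where "\<delta> = (\<lambda>p. (if 0 \<le> lin y g then 1 else - 1) * g p)"
    have dt: "\<delta> \<in> tangent y"
      using \<open>g \<in> tangent y\<close> by (auto simp: \<delta>_def tangent_def sum_negf)
    have dl: "lin (a j) \<delta> = 0" if "j \<in> J" for j
      using gl[OF that] by (simp add: lin_def \<delta>_def sum_negf)
    have slope: "0 \<le> lin y \<delta>" by (simp add: lin_def \<delta>_def sum_negf)
    have pos: "0 < lin \<delta> \<delta>"
    proof -
      obtain p where p: "p \<in> P" "g p \<noteq> 0" using g(1) free_subset by blast
      then have "0 < \<delta> p * \<delta> p" by (auto simp: \<delta>_def zero_less_mult_iff)
      also have "\<dots> \<le> lin \<delta> \<delta>" unfolding lin_def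
        by (rule member_le_sum) (use p finite_atoms in auto)
      finally show ?thesis .
    qed
    have "\<forall>\<^sub>F e in at_right 0. move y \<delta> e \<in> weights \<and> e > 0"
      using eventually_move_in_weights[OF yw dt]
      by (auto simp: eventually_conj_iff eventually_at_right_less eventually_at_filter elim!: eventually_mono)
    then obtain e where e: "move y \<delta> e \<in> weights" "e > 0"
      using eventually_happens[of _ "at_right (0::real)"] by fastforce
    have "move y \<delta> e \<in> M" using e dl yl by (simp add: M_def lin_move)
    from min[OF this] have "2 * e * lin y \<delta> + e\<^sup>2 * lin \<delta> \<delta> \<le> 0"
      by (simp add: defect_move[OF dt])
    moreover have "0 \<le> 2 * e * lin y \<delta>" using slope e by simp
    moreover have "0 < e\<^sup>2 * lin \<delta> \<delta>" using pos e by simp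
    ultimately show False by linarith
  qed
  then show ?thesis using yw yl by blast
qed

text \<open>A class without free atoms has an atom of weight \<open>1\<close>, and choosing it is exact. In any other class the
chosen entry and the weighted mean both lie in \<open>[-1,1]\<close>. The same choice serves all \<open>a\<close> at once.\<close>

lemma round_weights:
  assumes x: "x \<in> weights"
  shows "\<exists>f. (\<forall>i\<in>K. f i \<in> P \<and> col (f i) = i) \<and>
     (\<forall>a. (\<forall>p\<in>P. \<bar>a p\<bar> \<le> 1) \<longrightarrow>
        \<bar>(\<Sum>i\<in>K. a (f i)) - lin a x\<bar> \<le> 2 * real (card (free_classes x)))"
proof -
  obtain f where f: "\<And>i. i \<in> K \<Longrightarrow> f i \<in> P" "\<And>i. i \<in> K \<Longrightarrow> col (f i) = i" "\<And>i. i \<in> K \<Longrightarrow> 0 < x (f i)"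
    using class_has_positive[OF x] by metis
  have "\<bar>(\<Sum>i\<in>K. a (f i)) - lin a x\<bar> \<le> 2 * real (card (free_classes x))"
    if a: "\<And>p. p \<in> P \<Longrightarrow> \<bar>a p\<bar> \<le> 1" for a
  proof -
    define avg where "avg i = (\<Sum>p | p \<in> P \<and> col p = i. a p * x p)" for i
    have "\<bar>a (f i) - avg i\<bar> \<le> (if i \<in> free_classes x then 2 else 0)" if i: "i \<in> K" for i
    proof (cases "i \<in> free_classes x")
      case True
      have "\<bar>avg i\<bar> \<le> (\<Sum>p | p \<in> P \<and> col p = i. x p)"
        unfolding avg_def
        by (intro order_trans[OF sum_abs] sum_mono)
           (use a weights_nonneg[OF x] in \<open>auto simp: abs_mult intro: mult_left_le_one_le\<close>)
      also have "\<dots> = 1" using x i by (simp add: weights_def)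
      finally show ?thesis using a[OF f(1)[OF i]] True by auto
    next
      case False
      have "f i \<notin> free x" using False imageI[of "f i" "free x" col] f(2)[OF i] by (auto simp: free_classes_def)
      then have one: "x (f i) = 1"
        using f[OF i] weights_le_1[OF x, of "f i"] by (auto simp: free_def)
      have "x p = 0" if p: "p \<in> P" "col p = i" "p \<noteq> f i" for p
      proof -
        have "sum x {p, f i} \<le> 1" by (rule class_part_le_1[OF x i]) (use p f[OF i] in auto)
        then show ?thesis using p one weights_nonneg[OF x, of p] by simp
      qed
      then have "avg i = (\<Sum>p\<in>{f i}. a p * x p)"
        unfolding avg_def using f[OF i] finite_atoms by (intro sum.mono_neutral_right) auto
      then show ?thesis using one False by simp
    qed
    then have "(\<Sum>i\<in>K. \<bar>a (f i) - avg i\<bar>) \<le> (\<Sum>i\<in>K. if i \<in> free_classes x then 2 else 0)"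
      by (rule sum_mono)
    also have "\<dots> = 2 * real (card (free_classes x))"
      using free_classes_subset[of x] finite_classes
      by (simp add: sum.If_cases Int_absorb1)
    finally have "(\<Sum>i\<in>K. \<bar>a (f i) - avg i\<bar>) \<le> 2 * real (card (free_classes x))" .
    moreover have "(\<Sum>i\<in>K. a (f i)) - lin a x = (\<Sum>i\<in>K. a (f i) - avg i)"
      unfolding avg_def sum_subtractf lin_def by (simp only: sum_by_classes)
    ultimately show ?thesis using sum_abs[of "\<lambda>i. a (f i) - avg i" K] by linarith
  qed
  then show ?thesis using f by blast
qed

end

section \<open>Second-order behaviour of the barrier\<close>

lemma inverse_square_expansion:
  fixes s x :: real
  assumes "s \<noteq> 0" "s + x \<noteq> 0"
  shows "1 / (s + x)\<^sup>2 = 1 / s\<^sup>2 - 2 * x / s ^ 3 + x\<^sup>2 * (3 * s + 2 * x) / (s ^ 3 * (s + x)\<^sup>2)"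
proof -
  have "(s + x)\<^sup>2 \<noteq> 0" using assms by simp
  then show ?thesis using assms(1)
    by (simp add: divide_simps power2_eq_square power3_eq_cube) algebra
qed

text \<open>The symmetric difference of the barrier \<open>1 / s\<^sup>2\<close> to second order: moving by \<open>\<plusminus> e\<close> changes the slack
linearly by \<open>\<plusminus> e * b\<close>, which costs by convexity, while the drift \<open>\<kappa> * e\<^sup>2\<close> of the slack gains.\<close>

lemma second_difference_inverse_square:
  fixes s b \<kappa> :: real
  assumes "s > 0"
  shows "((\<lambda>e. (1 / (s + \<kappa> * e\<^sup>2 - e * b)\<^sup>2 + 1 / (s + \<kappa> * e\<^sup>2 + e * b)\<^sup>2 - 2 / s\<^sup>2) / e\<^sup>2)
     \<longlongrightarrow> 6 * b\<^sup>2 / s ^ 4 - 4 * \<kappa> / s ^ 3) (at_right 0)"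
proof -
  \<comment> \<open>The remainder of the first-order expansion after a displacement \<open>\<kappa> * e\<^sup>2 + e * b\<close>, divided by \<open>e\<^sup>2\<close>.\<close>
  define h where "h b e = (\<kappa> * e + b)\<^sup>2 * (3 * s + 2 * (\<kappa> * e\<^sup>2 + e * b)) / (s ^ 3 * (s + (\<kappa> * e\<^sup>2 + e * b))\<^sup>2)" for b e
  have lim: "(h b \<longlongrightarrow> 3 * b\<^sup>2 / s ^ 4) (at_right 0)" for b
  proof -
    have "(h b \<longlongrightarrow> (\<kappa> * 0 + b)\<^sup>2 * (3 * s + 2 * (\<kappa> * 0\<^sup>2 + 0 * b)) / (s ^ 3 * (s + (\<kappa> * 0\<^sup>2 + 0 * b))\<^sup>2)) (at_right 0)"
      unfolding h_def using assms by (intro tendsto_intros) auto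
    also have "(\<kappa> * 0 + b)\<^sup>2 * (3 * s + 2 * (\<kappa> * 0\<^sup>2 + 0 * b)) / (s ^ 3 * (s + (\<kappa> * 0\<^sup>2 + 0 * b))\<^sup>2) = 3 * b\<^sup>2 / s ^ 4"
      using assms by (simp add: divide_simps power2_eq_square eval_nat_numeral)
    finally show ?thesis .
  qed
  have nz: "\<forall>\<^sub>F e in at_right 0. s + (\<kappa> * e\<^sup>2 + e * b) > 0" for b
  proof -
    have "((\<lambda>e. s + (\<kappa> * e\<^sup>2 + e * b)) \<longlongrightarrow> s + (\<kappa> * 0\<^sup>2 + 0 * b)) (at_right 0)"
      by (intro tendsto_intros)
    from order_tendstoD(1)[OF this, of 0] assms show ?thesis by simp
  qed
  have "\<forall>\<^sub>F e in at_right 0. h (- b) e + h b e - 4 * \<kappa> / s ^ 3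
      = (1 / (s + \<kappa> * e\<^sup>2 - e * b)\<^sup>2 + 1 / (s + \<kappa> * e\<^sup>2 + e * b)\<^sup>2 - 2 / s\<^sup>2) / e\<^sup>2"
    using nz[of b] nz[of "- b"] eventually_at_right_less[of 0]
  proof eventually_elim
    case (elim e)
    have one: "1 / (s + (\<kappa> * e\<^sup>2 + e * c))\<^sup>2 = 1 / s\<^sup>2 - 2 * (\<kappa> * e\<^sup>2 + e * c) / s ^ 3 + e\<^sup>2 * h c e"
      if "s + (\<kappa> * e\<^sup>2 + e * c) > 0" for c
    proof -
      have "(\<kappa> * e\<^sup>2 + e * c)\<^sup>2 = e\<^sup>2 * (\<kappa> * e + c)\<^sup>2" by (simp add: power2_eq_square algebra_simps)
      then show ?thesis
        using inverse_square_expansion[of s "\<kappa> * e\<^sup>2 + e * c"] assms that by (simp add: h_def)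
    qed
    have "1 / (s + \<kappa> * e\<^sup>2 - e * b)\<^sup>2 + 1 / (s + \<kappa> * e\<^sup>2 + e * b)\<^sup>2 - 2 / s\<^sup>2
        = e\<^sup>2 * (h (- b) e + h b e - 4 * \<kappa> / s ^ 3)"
      using one[of b] one[of "- b"] elim(1,2) by (simp add: divide_inverse algebra_simps)
    then show ?case using elim(3) by simp
  qed
  moreover have "((\<lambda>e. h (- b) e + h b e - 4 * \<kappa> / s ^ 3)
      \<longlongrightarrow> 3 * (- b)\<^sup>2 / s ^ 4 + 3 * b\<^sup>2 / s ^ 4 - 4 * \<kappa> / s ^ 3) (at_right 0)"
    by (intro tendsto_intros lim)
  ultimately show ?thesis
    using Lim_transform_eventually by (fastforce simp: field_simps)
qed

lemma sqrt_diff_le: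
  fixes t :: real
  assumes "0 < t" "h \<le> t"
  shows "sqrt (t - h) \<le> sqrt t - h / (2 * sqrt t)"
proof (rule real_le_lsqrt)
  have "h / (2 * sqrt t) \<le> sqrt t"
    using assms by (subst pos_divide_le_eq) (auto simp: mult.left_commute[of "sqrt t"])
  then show "0 \<le> sqrt t - h / (2 * sqrt t)" by simp
  have "(sqrt t - h / (2 * sqrt t))\<^sup>2 = t - h + (h / (2 * sqrt t))\<^sup>2"
    using assms(1) by (simp add: power2_diff)
  then show "t - h \<le> (sqrt t - h / (2 * sqrt t))\<^sup>2" by simp
qed

section \<open>Balanced weights with few undecided families\<close>

context partitioned_atoms
begin

text \<open>Among the tangent directions orthogonal to \<open>x\<close> and to the rows in \<open>B\<close>, a space of dimension at least
\<open>N / 2 - 1\<close>, some direction has small quadratic form. Orthogonality to \<open>x\<close> makes the defect decrease by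
exactly \<open>e\<^sup>2\<close> for a step of length \<open>e\<close>. The factor \<open>4 * N / (N - 2)\<close> is \<open>2 * N\<close>, a bound for the number
of free atoms, divided by that dimension.\<close>

lemma light_tangent_direction:
  fixes a :: "'r \<Rightarrow> 'p \<Rightarrow> real" and w :: "'r \<Rightarrow> real"
  assumes x: "x \<in> weights" and R: "finite R" and B: "B \<subseteq> R"
    and a: "\<And>r p. r \<in> R \<Longrightarrow> p \<in> P \<Longrightarrow> \<bar>a r p\<bar> \<le> 1"
    and w: "\<And>r. r \<in> R \<Longrightarrow> 0 \<le> w r"
    and N: "real N = real (card (free x)) - real (card (free_classes x))"
    and N10: "10 < N" and half: "2 * card B \<le> N"
  shows "\<exists>\<delta>\<in>tangent x. lin \<delta> \<delta> = 1 \<and> lin x \<delta> = 0 \<and> (\<forall>r\<in>B. lin (a r) \<delta> = 0) \<and>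
           (\<Sum>r\<in>R. w r * (lin (a r) \<delta>)\<^sup>2) \<le> 4 * real N / (real N - 2) * (\<Sum>r\<in>R - B. w r)"
proof -
  define Q where "Q = class_indicator ` free_classes x \<union> insert x (a ` B)"
  have fB: "finite B" using R B finite_subset by blast
  have fQ: "finite Q" by (simp add: Q_def finite_free_classes fB)
  have "card Q \<le> card (class_indicator ` free_classes x) + card (insert x (a ` B))"
    unfolding Q_def by (rule card_Un_le)
  also have "\<dots> \<le> card (free_classes x) + Suc (card B)"
    using card_image_le[OF fB, of a] card_insert_le_m1[of "Suc (card B)" "a ` B" x]
    by (intro add_mono card_image_le finite_free_classes) auto
  finally have cQ: "card Q \<le> card (free_classes x) + Suc (card B)" .
  then have gap: "real N / 2 - 1 \<le> real (card (free x)) - real (card Q)"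
    using half N by linarith
  then have lt: "card Q < card (free x)" using N10 by linarith
  have fRB: "finite (R - B)" using R by simp
  have wRB: "0 \<le> w r" if "r \<in> R - B" for r
    using w that by blast
  have aRB: "\<bar>a r p\<bar> \<le> 1" if "r \<in> R - B" "p \<in> free x" for r p
    using a that free_subset by blast
  from light_direction[where w = w and a = a, OF fQ finite_free fRB lt wRB aRB]
  obtain \<delta> where d: "\<forall>p. p \<notin> free x \<longrightarrow> \<delta> p = 0" "(\<Sum>p\<in>free x. \<delta> p * \<delta> p) = 1"
    "\<forall>c\<in>Q. (\<Sum>p\<in>free x. c p * \<delta> p) = 0"
    and le: "(real (card (free x)) - real (card Q)) * (\<Sum>r\<in>R - B. w r * (\<Sum>p\<in>free x. a r p * \<delta> p)\<^sup>2)
       \<le> real (card (free x)) * (\<Sum>r\<in>R - B. w r)"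
    by blast
  have lin_eq: "(\<Sum>p\<in>free x. c p * \<delta> p) = lin c \<delta>" for c
    unfolding lin_def by (rule sum_free_eq[OF d(1)])
  have tangent: "\<delta> \<in> tangent x" by (rule tangentI) (use d in \<open>auto simp: Q_def\<close>)
  have perpB: "\<forall>r\<in>B. lin (a r) \<delta> = 0" and perpx: "lin x \<delta> = 0"
    using d(3) by (auto simp: Q_def lin_eq)
  define q where "q = (\<Sum>r\<in>R - B. w r * (lin (a r) \<delta>)\<^sup>2)"
  define W where "W = (\<Sum>r\<in>R - B. w r)"
  have q0: "0 \<le> q" unfolding q_def by (intro sum_nonneg) (use w in auto)
  have W0: "0 \<le> W" unfolding W_def by (intro sum_nonneg) (use w in auto)
  have "(real N / 2 - 1) * q \<le> (real (card (free x)) - real (card Q)) * q"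
    by (rule mult_right_mono[OF gap q0])
  also have "\<dots> \<le> real (card (free x)) * W" using le by (simp add: q_def W_def lin_eq)
  also have "\<dots> \<le> 2 * real N * W"
    using card_free_ge[OF x] N by (intro mult_right_mono W0) linarith
  finally have "q \<le> 4 * real N / (real N - 2) * W" using N10 by (simp add: field_simps)
  moreover have "(\<Sum>r\<in>R. w r * (lin (a r) \<delta>)\<^sup>2) = q"
    unfolding q_def using perpB R by (intro sum.mono_neutral_right) auto
  ultimately show ?thesis using tangent perpB perpx d(2) by (auto simp: W_def lin_eq)
qed

text \<open>The barrier argument. A point gets the potential \<open>\<Phi>\<close>, the sum over the rows of \<open>1 / s\<^sup>2\<close>, where the slack
\<open>s\<close> is measured against the moving bound \<open>11 * sqrt d - 6 * sqrt T\<close> with \<open>T\<close> the defect. As \<open>T\<close> drops from at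
most \<open>d\<close> to \<open>0\<close>, the bound grows from at least \<open>5 * sqrt d\<close> to \<open>11 * sqrt d\<close>, so the potential starts at most at
\<open>2 * d / (25 * d)\<close>.

At a minimiser of \<open>\<Phi>\<close>, let \<open>N\<close> be the dimension of the tangent space. By Markov's inequality, at most \<open>N / 2\<close>
rows have slack below \<open>5 * sqrt N / 2\<close>; these rows form \<open>B\<close> and are kept constant. On the other rows the
convexity cost, with weights \<open>1 / s ^ 4\<close>, is at most \<open>2 / (5 * sqrt N)\<close> times the same sum with \<open>1 / s ^ 3\<close>, the
weights of the gain from the moving bound. For \<open>N > 10\<close> a light direction has
\<open>4 * N / (N - 2) < 5\<close>, and since \<open>T \<le> N\<close> the gain then exceeds the cost, contradicting minimality.\<close>

lemma balanced_weights_with_few_free: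
  fixes a :: "'r \<Rightarrow> 'p \<Rightarrow> real" and d :: real
  assumes x0: "x\<^sub>0 \<in> weights" and R: "finite R" "R \<noteq> {}"
    and a: "\<And>r p. r \<in> R \<Longrightarrow> p \<in> P \<Longrightarrow> \<bar>a r p\<bar> \<le> 1"
    and d: "1 \<le> d" "card R \<le> 2 * d"
    and start: "\<And>r. r \<in> R \<Longrightarrow> lin (a r) x\<^sub>0 = 0" "defect x\<^sub>0 \<le> d"
  shows "\<exists>y\<in>weights. (\<forall>r\<in>R. lin (a r) y \<le> 11 * sqrt d) \<and>
           card (free y) \<le> card (free_classes y) + 10"
proof -
  define slack where "slack r x = 11 * sqrt d - 6 * sqrt (defect x) - lin (a r) x" for r x
  define \<Phi> where "\<Phi> x = (\<Sum>r\<in>R. 1 / (slack r x)\<^sup>2)" for x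
  \<comment> \<open>Slack at least \<open>3\<close> makes the domain compact and \<open>\<Phi>\<close> continuous on it. The value \<open>3\<close> lies below
    \<open>sqrt (25 / 2)\<close>, the least slack that \<open>\<Phi> x \<le> 2 / 25\<close> allows, so this constraint is inactive at the minimiser.\<close>
  define S where "S = weights \<inter> (\<Inter>r\<in>R. {x. 3 \<le> slack r x})"
  have cont: "continuous_on A (slack r)" for r A
    unfolding slack_def by (intro continuous_intros)
  have compS: "compact S" unfolding S_def
    by (intro compact_Int_closed compact_weights closed_INT ballI closed_Collect_le continuous_intros cont)
  have cont\<Phi>: "continuous_on S \<Phi>"
    unfolding \<Phi>_def using cont by (intro continuous_intros) (force simp: S_def)+
  have sqrtd: "1 \<le> sqrt d" using d by simp
  have slack0: "5 * sqrt d \<le> slack r x\<^sub>0" if "r \<in> R" for r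
    using start that by (simp add: slack_def)
  have "3 \<le> slack r x\<^sub>0" if "r \<in> R" for r using slack0[OF that] sqrtd by linarith
  then have x0S: "x\<^sub>0 \<in> S" using x0 by (simp add: S_def)
  have start\<Phi>: "\<Phi> x\<^sub>0 \<le> 2 / 25"
  proof -
    have "\<Phi> x\<^sub>0 \<le> (\<Sum>r\<in>R. 1 / (25 * d))" unfolding \<Phi>_def
    proof (intro sum_mono divide_left_mono)
      fix r assume r: "r \<in> R"
      have "(5 * sqrt d)\<^sup>2 \<le> (slack r x\<^sub>0)\<^sup>2"
        by (rule power_mono[OF slack0[OF r]]) (use d in auto)
      then show *: "25 * d \<le> (slack r x\<^sub>0)\<^sup>2" using d by (simp add: power_mult_distrib)
      show "0 < (slack r x\<^sub>0)\<^sup>2 * (25 * d)" using * d by (intro mult_pos_pos) linarith+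
    qed auto
    also have "\<dots> = card R / (25 * d)" by simp
    also have "\<dots> \<le> 2 / 25" using d by (simp add: field_simps)
    finally show ?thesis .
  qed
  obtain x where x: "x \<in> S" and min: "\<And>z. z \<in> S \<Longrightarrow> \<Phi> x \<le> \<Phi> z"
    using continuous_attains_inf[OF compS _ cont\<Phi>] x0S by blast
  have xw: "x \<in> weights" and s3: "\<And>r. r \<in> R \<Longrightarrow> 3 \<le> slack r x" using x by (auto simp: S_def)
  have \<Phi>x: "\<Phi> x \<le> 2 / 25" using min[OF x0S] start\<Phi> by linarith
  have s_strict: "3 < slack r x" if r: "r \<in> R" for r
  proof -
    have "1 / (slack r x)\<^sup>2 \<le> \<Phi> x" unfolding \<Phi>_def
      by (rule member_le_sum) (use r R in auto)
    then have "1 / (slack r x)\<^sup>2 \<le> 2 / 25" using \<Phi>x by linarith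
    then have "slack r x \<noteq> 3" by auto
    then show ?thesis using s3[OF r] by linarith
  qed
  have "card (free x) \<le> card (free_classes x) + 10"
  proof (rule ccontr)
    assume many: "\<not> ?thesis"
    define N where "N = card (free x) - card (free_classes x)"
    define T where "T = defect x"
    have N: "real N = real (card (free x)) - real (card (free_classes x))" and N10: "10 < N"
      using many by (auto simp: N_def)
    have kN: "card (free_classes x) \<le> N" using card_free_ge[OF xw] by (simp add: N_def)
    have TN: "T \<le> N" using defect_le[OF xw] kN unfolding T_def by linarith
    have "free x \<noteq> {}" using many by auto
    then have T0: "0 < T" unfolding T_def by (rule defect_pos[OF xw])
    \<comment> \<open>The rate at which the bound rises per unit of defect lost.\<close>
    define \<kappa> where "\<kappa> = 3 / sqrt T"
    define B where "B = {r\<in>R. 2 / (5 * sqrt N) < 1 / slack r x}"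
    have half: "2 * card B \<le> N"
    proof -
      have "card B * (4 / (25 * N)) = (\<Sum>r\<in>B. 4 / (25 * N))" by simp
      also have "\<dots> \<le> (\<Sum>r\<in>B. 1 / (slack r x)\<^sup>2)"
      proof (rule sum_mono)
        fix r assume "r \<in> B"
        then have "(2 / (5 * sqrt N))\<^sup>2 \<le> (1 / slack r x)\<^sup>2"
          by (intro power_mono) (auto simp: B_def)
        then show "4 / (25 * N) \<le> 1 / (slack r x)\<^sup>2" by (simp add: power_divide power_mult_distrib)
      qed
      also have "\<dots> \<le> \<Phi> x" unfolding \<Phi>_def
        by (rule sum_mono2) (use R in \<open>auto simp: B_def\<close>)
      finally have "card B * (4 / (25 * N)) \<le> 2 / 25" using \<Phi>x by linarith
      then have "2 * real (card B) \<le> real N" using N10 by (simp add: field_simps)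
      then show ?thesis by linarith
    qed
    have w: "0 \<le> 1 / (slack r x) ^ 4" for r by simp
    have BR: "B \<subseteq> R" by (auto simp: B_def)
    obtain \<delta> where \<delta>: "\<delta> \<in> tangent x" "lin \<delta> \<delta> = 1" "lin x \<delta> = 0"
      and light: "(\<Sum>r\<in>R. 1 / (slack r x) ^ 4 * (lin (a r) \<delta>)\<^sup>2)
          \<le> 4 * real N / (real N - 2) * (\<Sum>r\<in>R - B. 1 / (slack r x) ^ 4)"
      using light_tangent_direction[where a = a and w = "\<lambda>r. 1 / (slack r x) ^ 4",
          OF xw R(1) BR a w N N10 half] by blast
    define Y where "Y = (\<Sum>r\<in>R. 1 / (slack r x) ^ 3)"
    have Y: "0 < Y" unfolding Y_def using R s3 by (intro sum_pos) force+
    have coeff: "0 \<le> 4 * real N / (real N - 2)" using N10 by simp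
    have "(\<Sum>r\<in>R - B. 1 / (slack r x) ^ 4) \<le> (\<Sum>r\<in>R - B. 2 / (5 * sqrt N) * (1 / (slack r x) ^ 3))"
    proof (rule sum_mono)
      fix r assume r: "r \<in> R - B"
      then have "1 / slack r x * (1 / (slack r x) ^ 3) \<le> 2 / (5 * sqrt N) * (1 / (slack r x) ^ 3)"
        using s3[of r] by (intro mult_right_mono) (auto simp: B_def not_less)
      then show "1 / (slack r x) ^ 4 \<le> 2 / (5 * sqrt N) * (1 / (slack r x) ^ 3)"
        by (simp add: eval_nat_numeral)
    qed
    also have "\<dots> \<le> (\<Sum>r\<in>R. 2 / (5 * sqrt N) * (1 / (slack r x) ^ 3))"
      by (rule sum_mono2) (use R s3 in \<open>force+\<close>)
    also have "\<dots> = 2 / (5 * sqrt N) * Y" by (simp add: Y_def sum_distrib_left)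
    finally have "(\<Sum>r\<in>R. 1 / (slack r x) ^ 4 * (lin (a r) \<delta>)\<^sup>2)
        \<le> 4 * real N / (real N - 2) * (2 / (5 * sqrt N) * Y)"
      using light mult_left_mono[OF _ coeff] order_trans by blast
    also have "\<dots> < 5 * (2 / (5 * sqrt N) * Y)"
      using N10 Y by (intro mult_strict_right_mono) (auto simp: field_simps)
    also have "\<dots> = 2 / sqrt N * Y" by simp
    also have "\<dots> \<le> 2 / sqrt T * Y"
      using T0 TN Y by (intro mult_right_mono divide_left_mono) auto
    finally have curv: "6 * (\<Sum>r\<in>R. 1 / (slack r x) ^ 4 * (lin (a r) \<delta>)\<^sup>2) < 4 * \<kappa> * Y"
      by (simp add: \<kappa>_def)
    \<comment> \<open>A lower bound for the slack after a step \<open>- e\<close>: concavity of the square root turns the loss \<open>e\<^sup>2\<close> of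
      defect into a gain of at least \<open>\<kappa> * e\<^sup>2\<close>.\<close>
    define lo where "lo r e = slack r x + \<kappa> * e\<^sup>2 + e * lin (a r) \<delta>" for r e
    have slack_move: "lo r (- e) \<le> slack r (move x \<delta> e)" if "e\<^sup>2 \<le> T" for r e
    proof -
      have "sqrt (T - e\<^sup>2) \<le> sqrt T - e\<^sup>2 / (2 * sqrt T)" by (rule sqrt_diff_le[OF T0 that])
      then show ?thesis
        using \<delta> by (simp add: slack_def lo_def defect_move lin_move T_def \<kappa>_def)
    qed
    have limit: "((\<lambda>e. \<Sum>r\<in>R. (1 / (lo r (- e))\<^sup>2 + 1 / (lo r e)\<^sup>2 - 2 / (slack r x)\<^sup>2) / e\<^sup>2)
       \<longlongrightarrow> (\<Sum>r\<in>R. 6 * (lin (a r) \<delta>)\<^sup>2 / (slack r x) ^ 4 - 4 * \<kappa> / (slack r x) ^ 3)) (at_right 0)"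
    proof (intro tendsto_sum)
      fix r assume "r \<in> R"
      then have "0 < slack r x" using s3[of r] by linarith
      from second_difference_inverse_square[OF this, of \<kappa> "lin (a r) \<delta>"]
      show "((\<lambda>e. (1 / (lo r (- e))\<^sup>2 + 1 / (lo r e)\<^sup>2 - 2 / (slack r x)\<^sup>2) / e\<^sup>2)
       \<longlongrightarrow> 6 * (lin (a r) \<delta>)\<^sup>2 / (slack r x) ^ 4 - 4 * \<kappa> / (slack r x) ^ 3) (at_right 0)"
        by (simp add: lo_def)
    qed
    have "(\<Sum>r\<in>R. 6 * (lin (a r) \<delta>)\<^sup>2 / (slack r x) ^ 4 - 4 * \<kappa> / (slack r x) ^ 3) < 0"
      using curv by (simp add: sum_subtractf Y_def sum_distrib_left mult_ac)
    from order_tendstoD(2)[OF limit this]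
    have ev1: "\<forall>\<^sub>F e in at_right 0. (\<Sum>r\<in>R. (1 / (lo r (- e))\<^sup>2 + 1 / (lo r e)\<^sup>2 - 2 / (slack r x)\<^sup>2) / e\<^sup>2) < 0" .
    have "\<forall>\<^sub>F e in nhds 0. \<forall>r\<in>R. 3 < lo r e"
    proof (rule eventually_ball_finite[OF R(1)], rule ballI)
      fix r assume r: "r \<in> R"
      have "(lo r \<longlongrightarrow> slack r x + \<kappa> * 0\<^sup>2 + 0 * lin (a r) \<delta>) (nhds 0)"
        unfolding lo_def by (intro tendsto_intros filterlim_ident)
      from order_tendstoD(1)[OF this, of 3] s_strict[OF r]
      show "\<forall>\<^sub>F e in nhds 0. 3 < lo r e" by simp
    qed
    moreover have "\<forall>\<^sub>F e in nhds 0. e\<^sup>2 \<le> T"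
    proof -
      have "((\<lambda>e::real. e\<^sup>2) \<longlongrightarrow> 0\<^sup>2) (nhds 0)" by (intro tendsto_intros filterlim_ident)
      from order_tendstoD(2)[OF this, of T] T0 show ?thesis by (auto elim: eventually_mono)
    qed
    ultimately have good: "\<forall>\<^sub>F e in nhds 0. (\<forall>r\<in>R. 3 < lo r e) \<and> e\<^sup>2 \<le> T \<and> move x \<delta> e \<in> weights"
      using eventually_move_in_weights[OF xw \<delta>(1)] by (simp add: eventually_conj_iff)
    have at0: "filterlim (\<lambda>e. e) (nhds 0) (at_right (0::real))" "filterlim uminus (nhds 0) (at_right (0::real))"
      using tendsto_minus[OF tendsto_ident_at, of "0::real"] by (auto simp: filterlim_at)
    have bound: "\<Phi> x \<le> (\<Sum>r\<in>R. 1 / (lo r (- e))\<^sup>2)"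
      if "\<forall>r\<in>R. 3 < lo r (- e)" "e\<^sup>2 \<le> T" "move x \<delta> e \<in> weights" for e
    proof -
      have ge: "lo r (- e) \<le> slack r (move x \<delta> e)" for r using slack_move that by blast
      have gt: "3 < lo r (- e)" "3 < slack r (move x \<delta> e)" if "r \<in> R" for r
        using \<open>\<forall>r\<in>R. 3 < lo r (- e)\<close> that ge[of r] by force+
      have "move x \<delta> e \<in> S" using that(3) gt(2) by (auto simp: S_def less_imp_le)
      then have "\<Phi> x \<le> \<Phi> (move x \<delta> e)" by (rule min)
      also have "\<dots> \<le> (\<Sum>r\<in>R. 1 / (lo r (- e))\<^sup>2)" unfolding \<Phi>_def
      proof (intro sum_mono divide_left_mono power_mono ge)
        fix r assume "r \<in> R"
        then show "0 \<le> lo r (- e)" "0 < (slack r (move x \<delta> e))\<^sup>2 * (lo r (- e))\<^sup>2"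
          using gt[of r] by (auto intro!: mult_pos_pos)
      qed auto
      finally show ?thesis .
    qed
    \<comment> \<open>A step that is short enough in both orientations and lowers the sum of the two bounds for \<open>\<Phi>\<close>.\<close>
    obtain e where e: "(\<Sum>r\<in>R. (1 / (lo r (- e))\<^sup>2 + 1 / (lo r e)\<^sup>2 - 2 / (slack r x)\<^sup>2) / e\<^sup>2) < 0"
      "(\<forall>r\<in>R. 3 < lo r e) \<and> e\<^sup>2 \<le> T \<and> move x \<delta> e \<in> weights"
      "(\<forall>r\<in>R. 3 < lo r (- e)) \<and> (- e)\<^sup>2 \<le> T \<and> move x \<delta> (- e) \<in> weights"
      using eventually_happens'[OF trivial_limit_at_right_real
          eventually_conj[OF ev1 eventually_conj[OF eventually_compose_filterlim[OF good at0(1)]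
            eventually_compose_filterlim[OF good at0(2)]]]] by blast
    have "\<Phi> x \<le> (\<Sum>r\<in>R. 1 / (lo r (- e))\<^sup>2)" "\<Phi> x \<le> (\<Sum>r\<in>R. 1 / (lo r e)\<^sup>2)"
      using bound[of e] bound[of "- e"] e by auto
    moreover have "(\<Sum>r\<in>R. 2 / (slack r x)\<^sup>2) = 2 * \<Phi> x" by (simp add: \<Phi>_def sum_distrib_left)
    ultimately have "0 \<le> (\<Sum>r\<in>R. 1 / (lo r (- e))\<^sup>2 + 1 / (lo r e)\<^sup>2 - 2 / (slack r x)\<^sup>2)"
      by (simp add: sum.distrib sum_subtractf)
    then have "0 \<le> (\<Sum>r\<in>R. 1 / (lo r (- e))\<^sup>2 + 1 / (lo r e)\<^sup>2 - 2 / (slack r x)\<^sup>2) / e\<^sup>2" by simp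
    then show False using e(1) by (simp add: sum_divide_distrib)
  qed
  moreover have "lin (a r) x \<le> 11 * sqrt d" if "r \<in> R" for r
    using s3[OF that] real_sqrt_ge_zero[OF defect_nonneg[OF xw]] unfolding slack_def by linarith
  ultimately show ?thesis using xw by blast
qed

end

section \<open>Choosing one vector from each family\<close>

lemma infnorm_le_cart:
  fixes x :: "real ^ 'd"
  assumes "\<And>j. \<bar>x $ j\<bar> \<le> c"
  shows "infnorm x \<le> c"
  unfolding infnorm_cart by (rule cSup_least) (use assms in auto)

theorem theorem1p5:
  fixes n :: nat and V :: "nat \<Rightarrow> (real ^ 'd) set"
  assumes "n \<ge> 1"
    and "\<And>i. i \<in> {1..n} \<Longrightarrow> V i \<subseteq> ball_inf"
    and "0 \<in> (\<Sum>i = 1..n. convex hull (V i))"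
  shows "\<exists>v. (\<forall>i\<in>{1..n}. v i \<in> V i) \<and>
             infnorm (\<Sum>i = 1..n. v i) \<le> 22 * sqrt (real CARD('d))"
proof -
  have "\<exists>c. (\<forall>i\<in>{1..n}. c i \<in> convex hull V i) \<and> (\<Sum>i = 1..n. c i) = 0"
    using assms(3) unfolding set_sum_alt[OF finite_atLeastAtMost] by force
  then obtain c where c: "\<And>i. i \<in> {1..n} \<Longrightarrow> c i \<in> convex hull V i" "(\<Sum>i = 1..n. c i) = 0"
    by blast
  have "\<forall>i\<in>{1..n}. \<exists>S u. finite S \<and> S \<subseteq> V i \<and> (\<forall>v\<in>S. 0 \<le> u v) \<and> sum u S = 1 \<and>
      (\<Sum>v\<in>S. u v *\<^sub>R v) = c i"
    using c(1) by (auto simp: convex_hull_explicit)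
  from bchoice[OF this] obtain S where "\<forall>i\<in>{1..n}. \<exists>u. finite (S i) \<and> S i \<subseteq> V i \<and>
      (\<forall>v\<in>S i. 0 \<le> u v) \<and> sum u (S i) = 1 \<and> (\<Sum>v\<in>S i. u v *\<^sub>R v) = c i" by blast
  from bchoice[OF this] obtain u
    where S: "\<And>i. i \<in> {1..n} \<Longrightarrow> finite (S i) \<and> S i \<subseteq> V i"
      and u: "\<And>i v. i \<in> {1..n} \<Longrightarrow> v \<in> S i \<Longrightarrow> 0 \<le> u i v" "\<And>i. i \<in> {1..n} \<Longrightarrow> sum (u i) (S i) = 1"
        "\<And>i. i \<in> {1..n} \<Longrightarrow> (\<Sum>v\<in>S i. u i v *\<^sub>R v) = c i"
    by blast
  define P where "P = Sigma {1..n} S"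
  define x\<^sub>0 where "x\<^sub>0 = (\<lambda>p. if p \<in> P then u (fst p) (snd p) else 0)"
  define a :: "'d \<Rightarrow> nat \<times> (real ^ 'd) \<Rightarrow> real" where "a = (\<lambda>j p. snd p $ j)"
  define d where "d = real CARD('d)"
  interpret partitioned_atoms P "{1..n}" fst
    by unfold_locales (use S in \<open>auto simp: P_def\<close>)
  have class_sum: "(\<Sum>p | p \<in> P \<and> fst p = i. h p) = (\<Sum>v\<in>S i. h (i, v))"
    if "i \<in> {1..n}" for i and h :: "nat \<times> (real ^ 'd) \<Rightarrow> real"
    by (rule sum.reindex_bij_witness[of _ "\<lambda>v. (i, v)" snd]) (use that in \<open>auto simp: P_def\<close>)
  have x0: "x\<^sub>0 \<in> weights"
    unfolding weights_def mem_Collect_eq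
  proof (intro conjI allI ballI impI)
    fix i assume i: "i \<in> {1..n}"
    then have "(\<Sum>p | p \<in> P \<and> fst p = i. x\<^sub>0 p) = (\<Sum>v\<in>S i. u i v)"
      unfolding class_sum[OF i] by (intro sum.cong) (auto simp: x\<^sub>0_def P_def)
    then show "(\<Sum>p | p \<in> P \<and> fst p = i. x\<^sub>0 p) = 1" using u(2)[OF i] by simp
  qed (use u(1) in \<open>auto simp: x\<^sub>0_def P_def\<close>)
  have "lin (a j) x\<^sub>0 = 0" for j
  proof -
    have "lin (a j) x\<^sub>0 = (\<Sum>i = 1..n. c i) $ j"
      unfolding lin_def sum_by_classes[symmetric] sum_component
    proof (rule sum.cong[OF refl])
      fix i assume i: "i \<in> {1..n}"
      then show "(\<Sum>p | p \<in> P \<and> fst p = i. a j p * x\<^sub>0 p) = c i $ j"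
        unfolding class_sum[OF i] u(3)[OF i, symmetric] sum_component
        by (intro sum.cong) (auto simp: a_def x\<^sub>0_def P_def)
    qed
    then show ?thesis unfolding c(2) by simp
  qed
  then obtain y where y: "y \<in> weights" "\<And>j. lin (a j) y = 0"
    "card (free y) \<le> card (free_classes y) + CARD('d)"
    using few_free_atoms[OF x0, of UNIV a] by auto
  then have ky: "card (free_classes y) \<le> d" using card_free_ge[OF y(1)] by (simp add: d_def)
  have a1: "\<bar>a j p\<bar> \<le> 1" if "p \<in> P" for j p
  proof -
    have "snd p \<in> ball_inf" using that S assms(2) by (fastforce simp: P_def)
    then show ?thesis using component_le_infnorm_cart[of "snd p" j] by (simp add: a_def ball_inf_def)
  qed
  have d1: "1 \<le> d" by (simp add: d_def Suc_le_eq)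
  \<comment> \<open>Rounding costs \<open>2\<close> per free class, so every \<open>z\<close> whose coordinates leave room for this is good enough.\<close>
  have choice: ?thesis if z: "z \<in> weights"
    and bound: "\<And>j. \<bar>lin (a j) z\<bar> + 2 * real (card (free_classes z)) \<le> 22 * sqrt d" for z
  proof -
    obtain f where f: "\<And>i. i \<in> {1..n} \<Longrightarrow> f i \<in> P \<and> fst (f i) = i"
      and r: "\<And>b. (\<forall>p\<in>P. \<bar>b p\<bar> \<le> 1) \<Longrightarrow> \<bar>(\<Sum>i = 1..n. b (f i)) - lin b z\<bar> \<le> 2 * real (card (free_classes z))"
      using round_weights[OF z] by blast
    have "snd (f i) \<in> V i" if "i \<in> {1..n}" for i
      using f[OF that] S[OF that] by (auto simp: P_def)
    moreover have "infnorm (\<Sum>i = 1..n. snd (f i)) \<le> 22 * sqrt d"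
    proof (rule infnorm_le_cart)
      fix j
      have "(\<Sum>i = 1..n. snd (f i)) $ j = (\<Sum>i = 1..n. a j (f i))" by (simp add: a_def)
      then show "\<bar>(\<Sum>i = 1..n. snd (f i)) $ j\<bar> \<le> 22 * sqrt d"
        using r[of "a j"] a1 bound[of j] by fastforce
    qed
    ultimately show ?thesis by (auto simp: d_def intro!: exI[of _ "\<lambda>i. snd (f i)"])
  qed
  show ?thesis
  proof (cases "d \<le> 4")
    case True
    \<comment> \<open>In low dimension \<open>y\<close> has at most \<open>d\<close> free classes, few enough to round them at once.\<close>
    have "d = sqrt d * sqrt d" using d1 by simp
    also have "\<dots> \<le> 2 * sqrt d"
      using True d1 real_sqrt_le_mono[of d 4] by (intro mult_right_mono) auto
    finally have "d \<le> 2 * sqrt d" .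
    then have "2 * real (card (free_classes y)) \<le> 22 * sqrt d" using ky d1 by linarith
    then show ?thesis using choice[OF y(1)] y(2) by simp
  next
    case False
    \<comment> \<open>The barrier bounds linear forms from above only, so every coordinate enters with both signs.\<close>
    define b where "b = (\<lambda>(j, s) p. s * a j p)"
    have lin_b: "lin (b (j, s)) z = s * lin (a j) z" for j s z
      by (simp add: lin_def b_def sum_distrib_left mult_ac)
    have "\<exists>z\<in>weights. (\<forall>r\<in>UNIV \<times> {1, - 1}. lin (b r) z \<le> 11 * sqrt d) \<and>
        card (free z) \<le> card (free_classes z) + 10"
    proof (rule balanced_weights_with_few_free[OF y(1)])
      show "card ((UNIV :: 'd set) \<times> {1, - 1 :: real}) \<le> 2 * d"
        by (simp add: card_cartesian_product d_def)
      show "defect y \<le> d" using defect_le[OF y(1)] ky by linarith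
      show "lin (b r) y = 0" for r using lin_b y(2) by (cases r) simp
    qed (use a1 d1 in \<open>auto simp: b_def abs_mult\<close>)
    then obtain z where z: "z \<in> weights" "card (free z) \<le> card (free_classes z) + 10"
      and bal: "\<forall>r\<in>UNIV \<times> {1, - 1}. lin (b r) z \<le> 11 * sqrt d" by blast
    have "\<bar>lin (a j) z\<bar> + 2 * real (card (free_classes z)) \<le> 22 * sqrt d" for j
    proof -
      have "lin (b (j, 1)) z \<le> 11 * sqrt d" "lin (b (j, - 1)) z \<le> 11 * sqrt d" using bal by blast+
      then have "\<bar>lin (a j) z\<bar> \<le> 11 * sqrt d" unfolding lin_b by linarith
      moreover have "card (free_classes z) \<le> 10" using card_free_ge[OF z(1)] z(2) by linarith
      moreover have "2 \<le> sqrt d" using False real_sqrt_le_mono[of 4 d] by simp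
      ultimately show ?thesis by linarith
    qed
    then show ?thesis by (rule choice[OF z(1)])
  qed
qed

end
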